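(* Let $A\in\mathbb{R}^{m_A\times n}$, $B\in\mathbb{R}^{m_B\times n}$, $\mathbf b\in\mathbb{R}^{m_A}$, $\mathbf d\in\mathbb{R}^{m_B}$, $\mathbf c\in\mathbb{R}^n$. Consider the linear program $LP=\min\{\mathbf c^T\mathbf x : \mathbf x\in P\}$, where $P=\{\mathbf x\in\mathbb{R}^n : A\mathbf x=\mathbf b,\ B\mathbf x\le \mathbf d\}$. Given a feasible solution $\mathbf x_0\in P$, the number of steepest-descent augmentations needed to solve $LP$ is at most $$\dim(P)\cdot\left|\left\{\frac{\mathbf c^T\mathbf g}{\|B\mathbf g\|_1} : \mathbf g\in\mathcal C(A,B)\right\}\right|.$$
   Context: **Circuits.** The set of circuits $\mathcal C(A,B)$ of $P$ consists of those $\mathbf g\in\ker(A)\setminus\{\mathbf 0\}$, normalized to coprime integer components, for which $B\mathbf g$ is support-minimal over the set $\{B\mathbf x : \mathbf x\in\ker(A)\setminus\{\mathbf 0\}\}$. For general purposes, any normalization giving a unique positive and a unique negative representative of each of these one-dimensional directions can be used instead. **Strictly feasible direction.** A direction $\mathbf y$ is strictly feasible at $\mathbf x\in P$ if there exists some $\alpha>0$ with $\mathbf x+\alpha\mathbf y\in P$. **Steepest-descent augmenting direction.** At $\mathbf x\in P$, this is any direction $\mathbf y\in\ker(A)$ which is strictly feasible at $\mathbf x$ and minimizes $\mathbf c^T\mathbf y/\|B\mathbf y\|_1$ over all such directions. It need not be a circuit. **Steepest-descent augmentation.** At $\mathbf x_i\in P$, this is a maximal augmenting step $\mathbf x_{i+1}=\mathbf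 x_i+\alpha_i\mathbf y_i$ along a steepest-descent augmenting direction $\mathbf y_i$ at $\mathbf x_i$. Augmenting means that $\mathbf y_i$ is strictly feasible at $\mathbf x_i$ and improving, i.e. $\mathbf c^T\mathbf y_i<0$. Maximal means that $\mathbf x_i+\alpha_i\mathbf y_i\in P$ but $\mathbf x_i+\alpha\mathbf y_i\notin P$ for any $\alpha>\alpha_i$. **Solving $LP$.** Starting at $\mathbf x_0$, successive steepest-descent augmentations are performed until an optimal solution is reached or the problem is determined to be unbounded. **Dimension.** $\dim(P)$ denotes the dimension of the polyhedron $P$.
   Formalization: It is additionally assumed that ker(A) ∩ ker(B) = {0}; otherwise every circuit g satisfies Bg = 0 and the quotients c^T g/‖Bg‖_1 in the bound are undefined. *)

theory Defs
  imports "HOL-Analysis.Analysis"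
begin

definition lp_feasible ::
    "real^'n^'p \<Rightarrow> real^'n^'q \<Rightarrow> real^'p \<Rightarrow> real^'q \<Rightarrow> (real^'n) set" where
  "lp_feasible A B b d = {x. A *v x = b \<and> (\<forall>i. (B *v x) $ i \<le> d $ i)}"

definition lp_optimal ::
    "real^'n^'p \<Rightarrow> real^'n^'q \<Rightarrow> real^'p \<Rightarrow> real^'q \<Rightarrow> real^'n \<Rightarrow> real^'n \<Rightarrow> bool" where
  "lp_optimal A B b d c x \<longleftrightarrow>
     x \<in> lp_feasible A B b d \<and> (\<forall>z \<in> lp_feasible A B b d. c \<bullet> x \<le> c \<bullet> z)"

definition norm1 :: "real^'q \<Rightarrow> real" where
  "norm1 v = (\<Sum>i\<in>UNIV. \<bar>v $ i\<bar>)"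

text \<open>
  Meaningful only if \<open>B *v y \<noteq> 0\<close>. This holds for all nonzero \<open>y\<close> in the kernel
  of \<open>A\<close> iff the two kernels intersect trivially, i.e. the feasible set contains no line
  (if it is nonempty).
\<close>
definition steepness :: "real^'n^'q \<Rightarrow> real^'n \<Rightarrow> real^'n \<Rightarrow> real" where
  "steepness B c y = (c \<bullet> y) / norm1 (B *v y)"

definition supp :: "real^'q \<Rightarrow> 'q set" where
  "supp v = {i. v $ i \<noteq> 0}"

definition circuit_direction :: "real^'n^'p \<Rightarrow> real^'n^'q \<Rightarrow> real^'n \<Rightarrow> bool" where
  "circuit_direction A B g \<longleftrightarrow> A *v g = 0 \<and> g \<noteq> 0 \<and>
     (\<forall>x. A *v x = 0 \<and> x \<noteq> 0 \<longrightarrow> \<not> supp (B *v x) \<subset> supp (B *v g))"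

text \<open>
  The normalization to coprime integer components need not exist for real matrices, so
  \<open>circuit_set A B C\<close> admits every normalization: \<open>C\<close> contains exactly one
  representative of each ray spanned by a circuit direction. A circuit direction and its
  negative span different rays, so each line has one positive and one negative
  representative. The coprime integer normalization is the instance
  \<open>circuit_set_coprime\<close> below.
\<close>
definition circuit_set :: "real^'n^'p \<Rightarrow> real^'n^'q \<Rightarrow> (real^'n) set \<Rightarrow> bool" where
  "circuit_set A B C \<longleftrightarrow>
     (\<forall>g\<in>C. circuit_direction A B g) \<and>
     (\<forall>g. circuit_direction A B g \<longrightarrow> (\<exists>!h. h \<in> C \<and> (\<exists>t>0. h = t *\<^sub>R g)))"

definition coprime_integer :: "real^'n \<Rightarrow> bool" where
  "coprime_integer g \<longleftrightarrow>
     (\<exists>z :: int^'n. g = (\<chi> i. of_int (z $ i)) \<and> Gcd (range (($) z)) = 1)"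

definition strictly_feasible ::
    "real^'n^'p \<Rightarrow> real^'n^'q \<Rightarrow> real^'p \<Rightarrow> real^'q \<Rightarrow> real^'n \<Rightarrow> real^'n \<Rightarrow> bool" where
  "strictly_feasible A B b d x y \<longleftrightarrow> (\<exists>\<alpha>>0. x + \<alpha> *\<^sub>R y \<in> lp_feasible A B b d)"

text \<open>The zero vector is not a direction: its steepness would be \<open>0 / 0\<close>.\<close>
definition steepest_descent_direction ::
    "real^'n^'p \<Rightarrow> real^'n^'q \<Rightarrow> real^'p \<Rightarrow> real^'q \<Rightarrow> real^'n \<Rightarrow> real^'n \<Rightarrow> real^'n \<Rightarrow> bool" where
  "steepest_descent_direction A B b d c x y \<longleftrightarrow>
     A *v y = 0 \<and> y \<noteq> 0 \<and> strictly_feasible A B b d x y \<and>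
     (\<forall>z. A *v z = 0 \<and> z \<noteq> 0 \<and> strictly_feasible A B b d x z \<longrightarrow>
        steepness B c y \<le> steepness B c z)"

definition sd_augmenting ::
    "real^'n^'p \<Rightarrow> real^'n^'q \<Rightarrow> real^'p \<Rightarrow> real^'q \<Rightarrow> real^'n \<Rightarrow> real^'n \<Rightarrow> real^'n \<Rightarrow> bool" where
  "sd_augmenting A B b d c x y \<longleftrightarrow> steepest_descent_direction A B b d c x y \<and> c \<bullet> y < 0"

definition maximal_step ::
    "real^'n^'p \<Rightarrow> real^'n^'q \<Rightarrow> real^'p \<Rightarrow> real^'q \<Rightarrow> real^'n \<Rightarrow> real^'n \<Rightarrow> real \<Rightarrow> bool" where
  "maximal_step A B b d x y \<alpha> \<longleftrightarrow>
     x + \<alpha> *\<^sub>R y \<in> lp_feasible A B b d \<and>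
     (\<forall>\<beta>>\<alpha>. x + \<beta> *\<^sub>R y \<notin> lp_feasible A B b d)"

definition sd_augmentation ::
    "real^'n^'p \<Rightarrow> real^'n^'q \<Rightarrow> real^'p \<Rightarrow> real^'q \<Rightarrow> real^'n \<Rightarrow> real^'n \<Rightarrow> real^'n \<Rightarrow> bool" where
  "sd_augmentation A B b d c x x' \<longleftrightarrow>
     (\<exists>y \<alpha>. sd_augmenting A B b d c x y \<and> maximal_step A B b d x y \<alpha> \<and> x' = x + \<alpha> *\<^sub>R y)"

text \<open>
  A ray along an augmenting direction \<open>y\<close> (so \<open>c \<bullet> y < 0\<close>) certifies that
  the linear program is unbounded; there is no maximal step along it.
\<close>
definition feasible_ray ::
    "real^'n^'p \<Rightarrow> real^'n^'q \<Rightarrow> real^'p \<Rightarrow> real^'q \<Rightarrow> real^'n \<Rightarrow> real^'n \<Rightarrow> bool" where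
  "feasible_ray A B b d x y \<longleftrightarrow> (\<forall>\<alpha>\<ge>0. x + \<alpha> *\<^sub>R y \<in> lp_feasible A B b d)"

definition sd_run ::
    "real^'n^'p \<Rightarrow> real^'n^'q \<Rightarrow> real^'p \<Rightarrow> real^'q \<Rightarrow> real^'n \<Rightarrow> real^'n \<Rightarrow> nat \<Rightarrow> (nat \<Rightarrow> real^'n) \<Rightarrow> bool" where
  "sd_run A B b d c x0 k x \<longleftrightarrow>
     x 0 = x0 \<and> (\<forall>i<k. sd_augmentation A B b d c (x i) (x (Suc i)))"

lemma coprime_integer_unique:
  fixes g h :: "real^'n"
  assumes "coprime_integer g" "coprime_integer h" "s > 0" "h = s *\<^sub>R g"
  shows "h = g"
proof -
  obtain z where z: "g = (\<chi> i. of_int (z $ i))" "Gcd (range (($) z)) = 1"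
    using assms(1) unfolding coprime_integer_def by blast
  obtain w where w: "h = (\<chi> i. of_int (w $ i))" "Gcd (range (($) w)) = 1"
    using assms(2) unfolding coprime_integer_def by blast
  have sw: "real_of_int (w $ i) = s * real_of_int (z $ i)" for i
    using assms(4) z(1) w(1) by (simp add: vec_eq_iff)
  obtain j where j: "z $ j \<noteq> 0"
  proof (rule ccontr)
    assume "\<not> thesis"
    then have "range (($) z) \<subseteq> {0}" using that by auto
    then show False using z(2) by (metis Gcd_0_iff zero_neq_one)
  qed
  have abs_j: "real_of_int \<bar>w $ j\<bar> = s * real_of_int \<bar>z $ j\<bar>"
    using sw[of j] assms(3) by (simp add: abs_mult)
  have "\<bar>z $ j\<bar> * w $ i = \<bar>w $ j\<bar> * z $ i" for i
  proof -
    have "real_of_int (\<bar>z $ j\<bar> * w $ i) = real_of_int (\<bar>w $ j\<bar> * z $ i)"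
      using sw[of i] abs_j by simp
    then show ?thesis using of_int_eq_iff by blast
  qed
  then have "(*) \<bar>z $ j\<bar> ` range (($) w) = (*) \<bar>w $ j\<bar> ` range (($) z)"
    by (simp add: image_image)
  then have "\<bar>z $ j\<bar> = \<bar>w $ j\<bar>"
    using Gcd_mult[of "\<bar>z $ j\<bar>" "range (($) w)"] Gcd_mult[of "\<bar>w $ j\<bar>" "range (($) z)"] z(2) w(2)
    by simp
  then have "s = 1" using abs_j j by auto
  then show ?thesis using assms(4) by simp
qed

lemma circuit_direction_scaleR:
  assumes "circuit_direction A B g" "t > 0"
  shows "circuit_direction A B (t *\<^sub>R g)"
proof -
  have "supp (B *v (t *\<^sub>R g)) = supp (B *v g)"
    using assms(2) by (auto simp: supp_def matrix_vector_mult_scaleR)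
  then show ?thesis
    using assms by (simp add: circuit_direction_def matrix_vector_mult_scaleR)
qed

lemma circuit_set_coprime:
  assumes "\<And>g. circuit_direction A B g \<Longrightarrow> \<exists>t>0. coprime_integer (t *\<^sub>R g)"
  shows "circuit_set A B {g. circuit_direction A B g \<and> coprime_integer g}"
  unfolding circuit_set_def
proof (intro conjI allI impI)
  fix g assume g: "circuit_direction A B g"
  obtain t where t: "t > 0" "coprime_integer (t *\<^sub>R g)" using assms[OF g] by blast
  show "\<exists>!h. h \<in> {g. circuit_direction A B g \<and> coprime_integer g} \<and> (\<exists>t>0. h = t *\<^sub>R g)"
  proof (rule ex1I[of _ "t *\<^sub>R g"])
    show "t *\<^sub>R g \<in> {g. circuit_direction A B g \<and> coprime_integer g} \<and> (\<exists>s>0. t *\<^sub>R g = s *\<^sub>R g)"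
      using t g circuit_direction_scaleR by blast
  next
    fix h assume h: "h \<in> {g. circuit_direction A B g \<and> coprime_integer g} \<and> (\<exists>s>0. h = s *\<^sub>R g)"
    then obtain s where s: "s > 0" "h = s *\<^sub>R g" by blast
    have "h = (s / t) *\<^sub>R (t *\<^sub>R g)" using s t by simp
    then show "h = t *\<^sub>R g"
      using coprime_integer_unique[OF t(2), of h "s / t"] h s t by simp
  qed
qed auto

end

theory Submission imports Defs begin

text \<open>
  The minimal steepness at a point is always attained by a circuit, by reducing the support of a
  steepest direction, and it never decreases along a run, by the triangle inequality for the
  one-norm. So it remains to bound the number of steps of one fixed steepness. These steps have
  pairwise sign-compatible images under \<open>B\<close>, and each maximal step makes some row of
  \<open>B\<close> tight on which all later steps of the same steepness must vanish. Hence they are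
  linearly independent vectors in the direction space of the polyhedron.
\<close>

subsection \<open>The one-norm and steepness\<close>

lemma norm1_pos:
  assumes "v \<noteq> 0"
  shows "norm1 v > 0"
proof -
  obtain i where "v $ i \<noteq> 0" using assms by (auto simp: vec_eq_iff)
  then show ?thesis unfolding norm1_def by (intro sum_pos2[of _ i]) auto
qed

lemma norm1_scaleR: "norm1 (t *\<^sub>R v) = \<bar>t\<bar> * norm1 v"
  by (simp add: norm1_def abs_mult sum_distrib_left)

lemma norm1_triangle: "norm1 (u + v) \<le> norm1 u + norm1 v"
  unfolding norm1_def by (simp add: sum.distrib[symmetric] sum_mono)

lemma steepness_scaleR:
  "steepness B c (t *\<^sub>R y) = sgn t * steepness B c y"
  by (cases "t = 0")
    (simp_all add: steepness_def matrix_vector_mult_scaleR norm1_scaleR sgn_real_def)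

lemma steepness_eq_imp:
  assumes "B *v y \<noteq> 0"
  shows "c \<bullet> y = steepness B c y * norm1 (B *v y)"
  using norm1_pos[OF assms] by (simp add: steepness_def)

lemma steepness_le_iff:
  assumes "B *v y \<noteq> 0"
  shows "steepness B c y \<le> l \<longleftrightarrow> c \<bullet> y \<le> l * norm1 (B *v y)"
  using norm1_pos[OF assms] by (simp add: steepness_def pos_divide_le_eq)

lemma le_steepness_iff:
  assumes "B *v y \<noteq> 0"
  shows "l \<le> steepness B c y \<longleftrightarrow> l * norm1 (B *v y) \<le> c \<bullet> y"
  using norm1_pos[OF assms] by (simp add: steepness_def pos_le_divide_eq)


subsection \<open>Feasible directions\<close>

text \<open>Only tight rows obstruct a short step: a slack row stays slack for small steps by
  continuity, and finitely many rows share one such step length.\<close>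

lemma strictly_feasible_iff:
  assumes x: "x \<in> lp_feasible A B b d" and y: "A *v y = 0"
  shows "strictly_feasible A B b d x y \<longleftrightarrow> (\<forall>r. (B *v x) $ r = d $ r \<longrightarrow> (B *v y) $ r \<le> 0)"
proof
  assume "strictly_feasible A B b d x y"
  then obtain a where a: "a > 0" "\<And>r. (B *v x) $ r + a * (B *v y) $ r \<le> d $ r"
    unfolding strictly_feasible_def lp_feasible_def
    by (auto simp: matrix_vector_mult_scaleR matrix_vector_right_distrib)
  show "\<forall>r. (B *v x) $ r = d $ r \<longrightarrow> (B *v y) $ r \<le> 0"
  proof (intro allI impI)
    fix r assume "(B *v x) $ r = d $ r"
    then have "a * (B *v y) $ r \<le> 0" using a(2)[of r] by simp
    then show "(B *v y) $ r \<le> 0" using a(1) by (simp add: mult_le_0_iff)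
  qed
next
  assume tight: "\<forall>r. (B *v x) $ r = d $ r \<longrightarrow> (B *v y) $ r \<le> 0"
  have "\<forall>\<^sub>F a in at_right 0. (B *v x) $ r + a * (B *v y) $ r \<le> d $ r" for r
  proof (cases "(B *v x) $ r = d $ r")
    case True
    show ?thesis
      using eventually_at_right_less[of "0::real"]
      by eventually_elim (use tight True in \<open>auto simp: mult_le_0_iff\<close>)
  next
    case False
    then have "(B *v x) $ r + 0 * (B *v y) $ r < d $ r"
      using x by (auto simp: lp_feasible_def less_le)
    moreover have "((\<lambda>a. (B *v x) $ r + a * (B *v y) $ r) \<longlongrightarrow> (B *v x) $ r + 0 * (B *v y) $ r) (at_right 0)"
      by (intro tendsto_intros)
    ultimately have "\<forall>\<^sub>F a in at_right 0. (B *v x) $ r + a * (B *v y) $ r < d $ r"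
      by (rule order_tendstoD(2)[rotated])
    then show ?thesis by eventually_elim simp
  qed
  then have "\<forall>\<^sub>F a in at_right 0. \<forall>r. (B *v x) $ r + a * (B *v y) $ r \<le> d $ r"
    by (rule eventually_all_finite)
  then have "\<forall>\<^sub>F a in at_right 0. 0 < a \<and> (\<forall>r. (B *v x) $ r + a * (B *v y) $ r \<le> d $ r)"
    using eventually_at_right_less by (rule eventually_conj[rotated])
  then obtain a where "a > 0" "\<forall>r. (B *v x) $ r + a * (B *v y) $ r \<le> d $ r"
    using eventually_happens[OF _] trivial_limit_at_right_real by blast
  then show "strictly_feasible A B b d x y"
    using x y unfolding strictly_feasible_def lp_feasible_def
    by (auto simp: matrix_vector_mult_scaleR matrix_vector_right_distrib intro!: exI[of _ a])
qed

text \<open>At the endpoint \<open>y\<close> is no longer strictly feasible, as otherwise the step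
  could be prolonged; the tight-row criterion then yields the blocking row.\<close>

lemma maximal_step_tight_row:
  assumes y: "A *v y = 0" and max: "maximal_step A B b d x y \<alpha>"
  obtains r where "(B *v (x + \<alpha> *\<^sub>R y)) $ r = d $ r" "(B *v y) $ r > 0"
proof -
  have x': "x + \<alpha> *\<^sub>R y \<in> lp_feasible A B b d"
    using max by (simp add: maximal_step_def)
  have "\<not> strictly_feasible A B b d (x + \<alpha> *\<^sub>R y) y"
  proof
    assume "strictly_feasible A B b d (x + \<alpha> *\<^sub>R y) y"
    then obtain e where "e > 0" "x + \<alpha> *\<^sub>R y + e *\<^sub>R y \<in> lp_feasible A B b d"
      unfolding strictly_feasible_def by blast
    moreover have "x + \<alpha> *\<^sub>R y + e *\<^sub>R y = x + (\<alpha> + e) *\<^sub>R y"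
      by (simp add: algebra_simps)
    moreover have "\<alpha> < \<alpha> + e" using \<open>e > 0\<close> by simp
    ultimately show False using max unfolding maximal_step_def by metis
  qed
  then show thesis
    using that strictly_feasible_iff[OF x' y] by (meson not_le)
qed

lemma feasible_ray_or_maximal_step:
  assumes x: "x \<in> lp_feasible A B b d" and y: "A *v y = 0"
  shows "feasible_ray A B b d x y \<or> (\<exists>\<alpha>. maximal_step A B b d x y \<alpha>)"
proof (cases "\<forall>r. (B *v y) $ r \<le> 0")
  case True
  have "(B *v x) $ r + a * (B *v y) $ r \<le> d $ r" if "a \<ge> 0" for a r
  proof -
    have "a * (B *v y) $ r \<le> 0" using True that by (simp add: mult_nonneg_nonpos)
    moreover have "(B *v x) $ r \<le> d $ r" using x by (simp add: lp_feasible_def)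
    ultimately show ?thesis by simp
  qed
  then show ?thesis
    using x y unfolding feasible_ray_def lp_feasible_def
    by (auto simp: matrix_vector_mult_scaleR matrix_vector_right_distrib)
next
  case False
  define R where "R = {r. (B *v y) $ r > 0}"
  \<comment> \<open>Ratio test: \<open>q r\<close> is the step length at which row \<open>r\<close>
    becomes tight, so the least ratio is the maximal step.\<close>
  define q where "q r = (d $ r - (B *v x) $ r) / (B *v y) $ r" for r
  define a where "a = Min (q ` R)"
  have R: "finite (q ` R)" "q ` R \<noteq> {}" using False by (auto simp: R_def not_le)
  have feas: "x + t *\<^sub>R y \<in> lp_feasible A B b d \<longleftrightarrow> (\<forall>r. (B *v x) $ r + t * (B *v y) $ r \<le> d $ r)"
    for t
    using x y by (auto simp: lp_feasible_def matrix_vector_mult_scaleR matrix_vector_right_distrib)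
  have row: "(B *v x) $ r + t * (B *v y) $ r \<le> d $ r \<longleftrightarrow> t \<le> q r" if "r \<in> R" for r t
    using that by (simp add: q_def R_def pos_le_divide_eq algebra_simps)
  have xr: "(B *v x) $ r \<le> d $ r" for r using x by (simp add: lp_feasible_def)
  have "a \<ge> 0"
    unfolding a_def using R xr by (subst Min_ge_iff) (auto simp: q_def R_def)
  have "(B *v x) $ r + a * (B *v y) $ r \<le> d $ r" for r
  proof (cases "r \<in> R")
    case True
    then show ?thesis using row R by (simp add: a_def)
  next
    case False
    then have "a * (B *v y) $ r \<le> 0"
      using \<open>a \<ge> 0\<close> by (simp add: R_def mult_nonneg_nonpos)
    then show ?thesis using xr[of r] by simp
  qed
  moreover obtain r where "r \<in> R" "a = q r"
    using Min_in[OF R] unfolding a_def by auto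
  then have "\<not> (B *v x) $ r + t * (B *v y) $ r \<le> d $ r" if "t > a" for t
    using row that by simp
  ultimately have "maximal_step A B b d x y a"
    unfolding maximal_step_def feas by blast
  then show ?thesis by blast
qed


subsection \<open>Circuits attain the minimal steepness\<close>

text \<open>Where \<open>v\<close> vanishes both implications apply and force \<open>u\<close> to
  vanish. So \<open>u\<close> lies in the smallest face of an orthant that contains
  \<open>v\<close>, and on this face the one-norm is linear.\<close>

definition sign_compatible :: "real^'q \<Rightarrow> real^'q \<Rightarrow> bool" where
  "sign_compatible u v \<longleftrightarrow> (\<forall>r. (0 \<le> v $ r \<longrightarrow> 0 \<le> u $ r) \<and> (v $ r \<le> 0 \<longrightarrow> u $ r \<le> 0))"

lemma sign_compatible_trans:
  "sign_compatible u v \<Longrightarrow> sign_compatible v w \<Longrightarrow> sign_compatible u w"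
  by (auto simp: sign_compatible_def)

lemma sign_compatible_abs:
  assumes "sign_compatible u v"
  shows "\<bar>u $ r\<bar> = sgn (v $ r) * u $ r"
  using spec[OF assms[unfolded sign_compatible_def], of r]
  by (cases "v $ r" "0::real" rule: linorder_cases) (auto simp: sgn_real_def)

lemma norm1_sign_compatible:
  assumes "sign_compatible u v"
  shows "norm1 u = (\<Sum>r\<in>UNIV. sgn (v $ r) * u $ r)"
  using sign_compatible_abs[OF assms] by (simp add: norm1_def)

text \<open>
  Among the sign-compatible vectors of the kernel, both the objective and the one-norm are linear.
  So moving from \<open>y\<close> along \<open>x\<close> or \<open>-x\<close> does not increase the steepness,
  and either this motion hits a new zero entry or the direction of motion is itself compatible with \<open>y\<close>.
\<close>
lemma support_reduction:
  fixes A :: "real^'n^'p" and B :: "real^'n^'q"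
  assumes pointed: "\<And>y. A *v y = 0 \<Longrightarrow> B *v y = 0 \<Longrightarrow> y = 0"
    and y: "A *v y = 0" "y \<noteq> 0"
    and nc: "\<not> circuit_direction A B y"
  obtains z where "A *v z = 0" "z \<noteq> 0" "supp (B *v z) \<subset> supp (B *v y)"
    "sign_compatible (B *v z) (B *v y)" "steepness B c z \<le> steepness B c y"
proof -
  define l where "l = steepness B c y"
  have By: "B *v y \<noteq> 0" using pointed y by blast
  obtain x0 where x0: "A *v x0 = 0" "x0 \<noteq> 0" "supp (B *v x0) \<subset> supp (B *v y)"
    using nc y unfolding circuit_direction_def by blast
  \<comment> \<open>The one-norm is replaced by its linear extension from the face of
    \<open>B *v y\<close>. This makes \<open>F\<close> linear, with \<open>F y = 0\<close>, and for
    sign-compatible nonzero kernel vectors \<open>F z \<le> 0\<close> means steepness at most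
    \<open>l\<close>.\<close>
  define F where "F z = c \<bullet> z - l * (\<Sum>r\<in>UNIV. sgn ((B *v y) $ r) * (B *v z) $ r)" for z
  have F_add: "F (u + v) = F u + F v" for u v
    by (simp add: F_def inner_add_right matrix_vector_right_distrib algebra_simps sum.distrib)
  have F_scale: "F (t *\<^sub>R u) = t * F u" for t u
    by (simp add: F_def matrix_vector_mult_scaleR right_diff_distrib sum_distrib_left mult_ac)
  have F_le: "steepness B c z \<le> l"
    if "A *v z = 0" "z \<noteq> 0" "sign_compatible (B *v z) (B *v y)" "F z \<le> 0" for z
  proof -
    have "B *v z \<noteq> 0" using pointed that by blast
    then show ?thesis
      using that norm1_sign_compatible[OF that(3)] by (simp add: steepness_le_iff F_def)
  qed
  have "sign_compatible (B *v y) (B *v y)" by (simp add: sign_compatible_def)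
  from norm1_sign_compatible[OF this] have Fy: "F y = 0"
    using steepness_eq_imp[OF By, of c] by (simp add: F_def l_def)
  obtain x where x: "A *v x = 0" "x \<noteq> 0" "supp (B *v x) \<subset> supp (B *v y)" "F x \<le> 0"
  proof (cases "F x0 \<le> 0")
    case True
    then show ?thesis using that x0 by blast
  next
    case False
    have "B *v (- x0) = - (B *v x0)" "A *v (- x0) = - (A *v x0)"
      using matrix_vector_mult_scaleR[of B "-1" x0] matrix_vector_mult_scaleR[of A "-1" x0]
      by simp_all
    moreover have "F (- x0) = - F x0" using F_scale[of "-1" x0] by simp
    ultimately show ?thesis using that[of "- x0"] x0 False by (simp add: supp_def)
  qed
  have xy: "(B *v y) $ r = 0 \<Longrightarrow> (B *v x) $ r = 0" for r
    using x(3) by (auto simp: supp_def)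
  \<comment> \<open>These are the rows whose entry of \<open>B *v y\<close> is driven towards zero
    by moving along \<open>x\<close>. If there are none, \<open>x\<close> itself is
    sign-compatible.\<close>
  define R where "R = {r. (B *v x) $ r * (B *v y) $ r < 0}"
  show thesis
  proof (cases "R = {}")
    case True
    have "0 \<le> (B *v x) $ r * (B *v y) $ r" for r using True by (auto simp: R_def not_less)
    then have "sign_compatible (B *v x) (B *v y)"
      unfolding sign_compatible_def
      by (metis linorder_le_less_linear mult_pos_neg order_le_less xy mult_neg_pos order_less_irrefl
          order_le_less_trans)
    then show thesis using that[of x] x F_le l_def by blast
  next
    case False
    define q where "q r = - (B *v y) $ r / (B *v x) $ r" for r
    \<comment> \<open>The first time at which an entry of \<open>B *v (y + t *\<^sub>R x)\<close>
      reaches zero, hence before any sign change.\<close>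
    define t where "t = Min (q ` R)"
    have R: "finite (q ` R)" "q ` R \<noteq> {}" using False by auto
    have "q r > 0" if "r \<in> R" for r
      using that by (auto simp: R_def q_def mult_less_0_iff divide_less_0_iff)
    then have "t > 0" unfolding t_def using R by auto
    have t_le: "t \<le> q r" if "r \<in> R" for r using R that by (simp add: t_def)
    define z where "z = y + t *\<^sub>R x"
    have Bz: "(B *v z) $ r = (B *v y) $ r + t * (B *v x) $ r" for r
      by (simp add: z_def matrix_vector_mult_scaleR matrix_vector_right_distrib)
    have compat: "(0 \<le> (B *v y) $ r \<longrightarrow> 0 \<le> (B *v z) $ r) \<and> ((B *v y) $ r \<le> 0 \<longrightarrow> (B *v z) $ r \<le> 0)"
      for r
    proof (cases "r \<in> R")
      case True
      then consider "(B *v x) $ r > 0" "(B *v y) $ r < 0" | "(B *v x) $ r < 0" "(B *v y) $ r > 0"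
        by (auto simp: R_def mult_less_0_iff)
      then show ?thesis
        using t_le[OF True] by cases (simp_all add: Bz q_def field_simps)
    next
      case False
      then have nn: "0 \<le> (B *v x) $ r * (B *v y) $ r" by (auto simp: R_def not_less)
      consider "(B *v y) $ r = 0" | "(B *v y) $ r > 0" | "(B *v y) $ r < 0" by linarith
      then show ?thesis
      proof cases
        case 1
        then show ?thesis using xy by (simp add: Bz)
      next
        case 2
        then have "0 \<le> t * (B *v x) $ r" using nn \<open>t > 0\<close> by (simp add: zero_le_mult_iff)
        then show ?thesis using 2 by (simp add: Bz)
      next
        case 3
        then have "t * (B *v x) $ r \<le> 0"
          using nn \<open>t > 0\<close> by (simp add: zero_le_mult_iff mult_le_0_iff)
        then show ?thesis using 3 by (simp add: Bz)
      qed
    qed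
    obtain r where r: "r \<in> R" "t = q r"
      using Min_in[OF R] unfolding t_def by auto
    have Bzr: "(B *v z) $ r = 0" using r by (auto simp: Bz q_def R_def)
    have "supp (B *v z) \<subseteq> supp (B *v y)" using xy by (auto simp: supp_def Bz)
    moreover have "r \<in> supp (B *v y)" "r \<notin> supp (B *v z)"
      using r Bzr by (auto simp: supp_def R_def)
    ultimately have supp: "supp (B *v z) \<subset> supp (B *v y)" by blast
    \<comment> \<open>The support of \<open>B *v x\<close> is strictly smaller, so some nonzero
      entry of \<open>B *v y\<close> is untouched by the motion; this keeps \<open>z\<close>
      nonzero.\<close>
    obtain r' where "(B *v y) $ r' \<noteq> 0" "(B *v x) $ r' = 0"
      using x(3) by (auto simp: supp_def)
    then have "(B *v z) $ r' \<noteq> 0" by (simp add: Bz)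
    then have "z \<noteq> 0" by auto
    moreover have "A *v z = 0"
      using x y by (simp add: z_def matrix_vector_mult_scaleR matrix_vector_right_distrib)
    moreover have "F z \<le> 0"
      using Fy x(4) \<open>t > 0\<close> by (simp add: z_def F_add F_scale mult_nonneg_nonpos)
    moreover have "sign_compatible (B *v z) (B *v y)"
      using compat by (simp add: sign_compatible_def)
    ultimately show thesis using that supp F_le l_def by blast
  qed
qed

lemma exists_steeper_circuit:
  fixes A :: "real^'n^'p" and B :: "real^'n^'q"
  assumes pointed: "\<And>y. A *v y = 0 \<Longrightarrow> B *v y = 0 \<Longrightarrow> y = 0"
    and "A *v y = 0" "y \<noteq> 0"
  shows "\<exists>g. circuit_direction A B g \<and> sign_compatible (B *v g) (B *v y) \<and>
           steepness B c g \<le> steepness B c y"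
  using assms(2,3)
proof (induction "card (supp (B *v y))" arbitrary: y rule: less_induct)
  case less
  show ?case
  proof (cases "circuit_direction A B y")
    case True
    then show ?thesis by (auto simp: sign_compatible_def)
  next
    case False
    obtain z where z: "A *v z = 0" "z \<noteq> 0" "supp (B *v z) \<subset> supp (B *v y)"
      "sign_compatible (B *v z) (B *v y)" "steepness B c z \<le> steepness B c y"
      using support_reduction[OF pointed less.prems False] by blast
    have "card (supp (B *v z)) < card (supp (B *v y))"
      using z(3) by (simp add: psubset_card_mono)
    from less.hyps[OF this z(1,2)] show ?thesis
      using z(4,5) sign_compatible_trans order_trans by blast
  qed
qed

text \<open>Sign compatibility transfers strict feasibility: at a tight row \<open>B *v y\<close> is
  nonpositive, hence so is \<open>B *v g\<close>.\<close>

lemma exists_steeper_feasible_circuit: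
  fixes A :: "real^'n^'p" and B :: "real^'n^'q"
  assumes pointed: "\<And>y. A *v y = 0 \<Longrightarrow> B *v y = 0 \<Longrightarrow> y = 0"
    and x: "x \<in> lp_feasible A B b d"
    and y: "A *v y = 0" "y \<noteq> 0" "strictly_feasible A B b d x y"
  obtains g where "circuit_direction A B g" "strictly_feasible A B b d x g"
    "steepness B c g \<le> steepness B c y"
proof -
  obtain g where g: "circuit_direction A B g" "sign_compatible (B *v g) (B *v y)"
    "steepness B c g \<le> steepness B c y"
    using exists_steeper_circuit[OF pointed y(1,2)] by blast
  have "A *v g = 0" using g(1) by (simp add: circuit_direction_def)
  then have "strictly_feasible A B b d x g"
    using g(2) y x by (auto simp: strictly_feasible_iff sign_compatible_def)
  then show thesis using that g by blast
qed

section \<open>Finiteness of the set of circuit steepnesses\<close>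

lemma circuit_direction_same_supp:
  assumes pointed: "\<And>y. A *v y = 0 \<Longrightarrow> B *v y = 0 \<Longrightarrow> y = 0"
    and g: "circuit_direction A B g" and h: "circuit_direction A B h"
    and eq: "supp (B *v h) = supp (B *v g)"
  obtains t where "h = t *\<^sub>R g"
proof -
  have "B *v g \<noteq> 0" using pointed g by (auto simp: circuit_direction_def)
  then obtain r where r: "(B *v g) $ r \<noteq> 0" by (auto simp: vec_eq_iff)
  define t where "t = (B *v h) $ r / (B *v g) $ r"
  \<comment> \<open>The multiple \<open>t\<close> is chosen to cancel entry \<open>r\<close>, so
    \<open>z\<close> has strictly smaller support than the circuit \<open>h\<close> and must be
    zero.\<close>
  define z where "z = h - t *\<^sub>R g"
  have Bz: "(B *v z) $ i = (B *v h) $ i - t * (B *v g) $ i" for i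
    by (simp add: z_def matrix_vector_mult_scaleR matrix_vector_mult_diff_distrib)
  have "supp (B *v z) \<subseteq> supp (B *v h)"
    using eq by (auto simp: supp_def Bz set_eq_iff)
  moreover have "r \<in> supp (B *v h)" "r \<notin> supp (B *v z)"
    using r by (auto simp: Bz t_def eq) (auto simp: supp_def Bz t_def)
  ultimately have "supp (B *v z) \<subset> supp (B *v h)" by blast
  moreover have "A *v z = 0"
    using g h
    by (simp add: z_def circuit_direction_def matrix_vector_mult_scaleR matrix_vector_mult_diff_distrib)
  ultimately have "z = 0" using h unfolding circuit_direction_def by blast
  then show thesis using that[of t] by (simp add: z_def)
qed

text \<open>There are finitely many supports, and circuits with equal support are multiples of each
  other, so their steepnesses differ at most by a sign factor.\<close>

lemma finite_circuit_steepness: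
  fixes A :: "real^'n^'p" and B :: "real^'n^'q"
  assumes pointed: "\<And>y. A *v y = 0 \<Longrightarrow> B *v y = 0 \<Longrightarrow> y = 0"
  shows "finite (steepness B c ` {g. circuit_direction A B g})"
proof -
  define G where "G S = {g. circuit_direction A B g \<and> supp (B *v g) = S}" for S
  have "finite (steepness B c ` G S)" for S
  proof (cases "G S = {}")
    case False
    then obtain g where g: "circuit_direction A B g" "supp (B *v g) = S"
      by (auto simp: G_def)
    \<comment> \<open>Including the factor 0 avoids a proof that \<open>t\<close> is
      nonzero.\<close>
    have "steepness B c ` G S \<subseteq> (\<lambda>s. s * steepness B c g) ` {-1, 0, 1}"
    proof
      fix v assume "v \<in> steepness B c ` G S"
      then obtain h where h: "circuit_direction A B h" "supp (B *v h) = S" "v = steepness B c h"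
        by (auto simp: G_def)
      obtain t where "h = t *\<^sub>R g"
        using circuit_direction_same_supp[OF pointed g(1) h(1)] g(2) h(2) by blast
      then have "v = sgn t * steepness B c g" by (simp add: h(3) steepness_scaleR)
      then show "v \<in> (\<lambda>s. s * steepness B c g) ` {-1, 0, 1}"
        by (auto simp: sgn_real_def)
    qed
    then show ?thesis by (rule finite_subset) simp
  qed simp
  then have "finite (\<Union>S. steepness B c ` G S)" by (intro finite_UN_I) auto
  moreover have "(\<Union>S. steepness B c ` G S) = steepness B c ` {g. circuit_direction A B g}"
    by (auto simp: G_def)
  ultimately show ?thesis by simp
qed

lemma circuit_set_steepness:
  assumes "circuit_set A B C"
  shows "{steepness B c g | g. g \<in> C} = steepness B c ` {g. circuit_direction A B g}"
proof (intro equalityI subsetI)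
  fix v assume "v \<in> {steepness B c g | g. g \<in> C}"
  then show "v \<in> steepness B c ` {g. circuit_direction A B g}"
    using assms by (auto simp: circuit_set_def)
next
  fix v assume "v \<in> steepness B c ` {g. circuit_direction A B g}"
  then obtain g where g: "circuit_direction A B g" "v = steepness B c g" by blast
  obtain h t where "h \<in> C" "t > 0" "h = t *\<^sub>R g"
    using assms g(1) unfolding circuit_set_def by blast
  then show "v \<in> {steepness B c g | g. g \<in> C}"
    using g(2) by (auto simp: steepness_scaleR intro!: exI[of _ h])
qed

text \<open>The minimum over infinitely many directions is attained: each is bounded below by a
  strictly feasible circuit, and circuits take finitely many steepness values.\<close>

lemma optimal_or_sd_augmenting:
  fixes A :: "real^'n^'p" and B :: "real^'n^'q"
  assumes pointed: "\<And>y. A *v y = 0 \<Longrightarrow> B *v y = 0 \<Longrightarrow> y = 0"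
    and x: "x \<in> lp_feasible A B b d"
  shows "lp_optimal A B b d c x \<or> (\<exists>y. sd_augmenting A B b d c x y)"
proof (cases "lp_optimal A B b d c x")
  case False
  then obtain w where w: "w \<in> lp_feasible A B b d" "c \<bullet> w < c \<bullet> x"
    using x by (auto simp: lp_optimal_def not_le)
  define y where "y = w - x"
  have y: "A *v y = 0" "y \<noteq> 0" "strictly_feasible A B b d x y"
    using x w
    by (auto simp: y_def lp_feasible_def strictly_feasible_def matrix_vector_mult_diff_distrib
        intro!: exI[of _ "1::real"])
  have cy: "c \<bullet> y < 0" using w(2) by (simp add: y_def inner_diff_right)
  define V where "V = steepness B c ` {g. circuit_direction A B g \<and> strictly_feasible A B b d x g}"
  have fin: "finite V"
    unfolding V_def by (rule finite_subset[OF _ finite_circuit_steepness[of A B c]]) (use pointed in auto)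
  have below: "\<exists>v\<in>V. v \<le> steepness B c z"
    if z: "A *v z = 0" "z \<noteq> 0" "strictly_feasible A B b d x z" for z
  proof -
    obtain g where "circuit_direction A B g" "strictly_feasible A B b d x g"
      "steepness B c g \<le> steepness B c z"
      using exists_steeper_feasible_circuit[OF pointed x z] by blast
    then show ?thesis by (auto simp: V_def)
  qed
  have "V \<noteq> {}" using below[OF y] by blast
  then obtain g where g: "circuit_direction A B g" "strictly_feasible A B b d x g"
    "steepness B c g = Min V"
    using Min_in[OF fin] by (auto simp: V_def)
  have min: "steepness B c g \<le> steepness B c z"
    if z: "A *v z = 0" "z \<noteq> 0" "strictly_feasible A B b d x z" for z
    using below[OF z] fin g(3) by (metis Min_le order_trans)
  have "steepness B c y < 0"
    using cy norm1_pos[of "B *v y"] pointed[OF y(1)] y(2)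
    by (auto simp: steepness_def divide_less_0_iff)
  then have "steepness B c g < 0" using min[OF y] by simp
  moreover have "B *v g \<noteq> 0" using g(1) pointed by (auto simp: circuit_direction_def)
  ultimately have "c \<bullet> g < 0"
    using norm1_pos[of "B *v g"] by (simp add: steepness_def divide_less_0_iff)
  then have "sd_augmenting A B b d c x g"
    using g min
    by (auto simp: sd_augmenting_def steepest_descent_direction_def circuit_direction_def)
  then show ?thesis by blast
qed simp


subsection \<open>Counting the augmentations\<close>

text \<open>Restates a step through its displacement, a positive multiple of the chosen direction.
  The bound over all feasible \<open>w\<close> allows comparison with displacements that span
  several steps.\<close>

lemma sd_augmentation_displacement:
  fixes A :: "real^'n^'p" and B :: "real^'n^'q"
  assumes pointed: "\<And>y. A *v y = 0 \<Longrightarrow> B *v y = 0 \<Longrightarrow> y = 0"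
    and x: "x \<in> lp_feasible A B b d"
    and step: "sd_augmentation A B b d c x x'"
  shows "x' \<in> lp_feasible A B b d"
    and "B *v (x' - x) \<noteq> 0"
    and "steepness B c (x' - x) < 0"
    and "\<And>w. w \<in> lp_feasible A B b d \<Longrightarrow>
           steepness B c (x' - x) * norm1 (B *v (w - x)) \<le> c \<bullet> (w - x)"
    and "steepness B c (x' - x) \<in> steepness B c ` {g. circuit_direction A B g}"
    and "\<exists>r. (B *v x') $ r = d $ r \<and> (B *v (x' - x)) $ r > 0"
proof -
  obtain y \<alpha> where y: "A *v y = 0" "y \<noteq> 0" "strictly_feasible A B b d x y" "c \<bullet> y < 0"
    and min: "\<And>z. A *v z = 0 \<Longrightarrow> z \<noteq> 0 \<Longrightarrow> strictly_feasible A B b d x z \<Longrightarrow>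
        steepness B c y \<le> steepness B c z"
    and max: "maximal_step A B b d x y \<alpha>" and x': "x' = x + \<alpha> *\<^sub>R y"
    using step
    unfolding sd_augmentation_def sd_augmenting_def steepest_descent_direction_def by blast
  show "x' \<in> lp_feasible A B b d" using max x' by (simp add: maximal_step_def)
  obtain \<beta> where "\<beta> > 0" "x + \<beta> *\<^sub>R y \<in> lp_feasible A B b d"
    using y(3) unfolding strictly_feasible_def by blast
  \<comment> \<open>Otherwise the feasible step \<open>\<beta>\<close> would exceed the maximal
    one.\<close>
  then have "\<alpha> > 0"
    using max unfolding maximal_step_def by (meson not_le order_less_le_trans)
  have By: "B *v y \<noteq> 0" using pointed y by blast
  have D: "x' - x = \<alpha> *\<^sub>R y" by (simp add: x')
  have l: "steepness B c (x' - x) = steepness B c y"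
    using \<open>\<alpha> > 0\<close> by (simp add: D steepness_scaleR)
  show "B *v (x' - x) \<noteq> 0" using By \<open>\<alpha> > 0\<close> by (simp add: D matrix_vector_mult_scaleR)
  show "steepness B c (x' - x) < 0"
    using y(4) norm1_pos[OF By] unfolding l by (simp add: steepness_def divide_less_0_iff)
  show "steepness B c (x' - x) * norm1 (B *v (w - x)) \<le> c \<bullet> (w - x)"
    if w: "w \<in> lp_feasible A B b d" for w
  \<comment> \<open>The zero vector is not a direction, so minimality says nothing about it; there
    both sides are 0.\<close>
  proof (cases "w = x")
    case True
    then show ?thesis by (simp add: norm1_def)
  next
    case False
    have Aw: "A *v (w - x) = 0"
      using x w by (simp add: lp_feasible_def matrix_vector_mult_diff_distrib)
    have "strictly_feasible A B b d x (w - x)"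
      using w by (auto simp: strictly_feasible_def intro!: exI[of _ "1::real"])
    then have "steepness B c y \<le> steepness B c (w - x)" using min Aw False by simp
    moreover have "B *v (w - x) \<noteq> 0" using pointed[OF Aw] False by auto
    ultimately show ?thesis by (simp add: l le_steepness_iff)
  qed
  obtain g where g: "circuit_direction A B g" "strictly_feasible A B b d x g"
    "steepness B c g \<le> steepness B c y"
    using exists_steeper_feasible_circuit[OF pointed x y(1-3)] by blast
  then have "steepness B c g = steepness B c y"
    using min[of g] by (force simp: circuit_direction_def)
  then show "steepness B c (x' - x) \<in> steepness B c ` {g. circuit_direction A B g}"
    using g(1) by (metis l image_eqI mem_Collect_eq)
  obtain r where "(B *v (x + \<alpha> *\<^sub>R y)) $ r = d $ r" "(B *v y) $ r > 0"
    using maximal_step_tight_row[OF y(1) max] by blast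
  then show "\<exists>r. (B *v x') $ r = d $ r \<and> (B *v (x' - x)) $ r > 0"
    using \<open>\<alpha> > 0\<close> by (auto simp: D x' matrix_vector_mult_scaleR intro!: exI[of _ r])
qed

text \<open>The matrix of the products \<open>w i \<bullet> y j\<close> is triangular with nonzero
  diagonal. Removing the least index \<open>m\<close>, all later vectors lie in the hyperplane
  orthogonal to \<open>w m\<close>, but \<open>y m\<close> does not.\<close>

lemma independent_triangular:
  fixes y w :: "nat \<Rightarrow> 'a::euclidean_space"
  assumes "finite I" "\<And>i. i \<in> I \<Longrightarrow> w i \<bullet> y i \<noteq> 0"
    "\<And>i j. i \<in> I \<Longrightarrow> j \<in> I \<Longrightarrow> i < j \<Longrightarrow> w i \<bullet> y j = 0"
  shows "inj_on y I \<and> independent (y ` I)"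
  using assms
proof (induction I rule: finite_linorder_min_induct)
  case empty
  then show ?case by (simp add: independent_empty)
next
  case (insert m I)
  have IH: "inj_on y I" "independent (y ` I)" using insert by auto
  have "span (y ` I) \<subseteq> {v. w m \<bullet> v = 0}"
    using insert by (intro span_minimal subspace_hyperplane) auto
  then have "y m \<notin> span (y ` I)" using insert.prems(1)[of m] by auto
  then show ?case
    using IH insert.hyps by (auto simp: independent_insert) (metis imageI span_base)+
qed

text \<open>
  The displacements of a stretch of constant steepness are pairwise sign-compatible, since otherwise
  the total displacement would be strictly steeper than the steepest direction at its start.
  A row that becomes tight in the stretch thus vanishes on all later displacements of the stretch.
\<close>
lemma tight_row_persists:
  fixes x :: "nat \<Rightarrow> real^'n" and B :: "real^'n^'q" and c :: "real^'n"
  assumes ij: "i < j" and neg: "l < 0"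
    and level: "\<And>m. m \<in> {i..j} \<Longrightarrow> c \<bullet> (x (Suc m) - x m) = l * norm1 (B *v (x (Suc m) - x m))"
    and total: "l * norm1 (B *v (x (Suc j) - x i)) \<le> c \<bullet> (x (Suc j) - x i)"
    and tight: "(B *v x (Suc i)) $ r = d $ r" "(B *v (x (Suc i) - x i)) $ r > 0"
    and feas: "(B *v x (Suc j)) $ r \<le> d $ r"
  shows "(B *v (x (Suc j) - x j)) $ r = 0"
proof -
  define D where "D m s = (B *v (x (Suc m) - x m)) $ s" for m s
  have D_eq: "D m s = (B *v x (Suc m)) $ s - (B *v x m) $ s" for m s
    by (simp add: D_def matrix_vector_mult_diff_distrib)
  have sumD: "(\<Sum>m=a..j. D m s) = (B *v x (Suc j)) $ s - (B *v x a) $ s" if "a \<le> Suc j" for a s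
    unfolding D_eq using that by (rule sum_Suc_diff)
  have "c \<bullet> (x (Suc j) - x i) = (\<Sum>m=i..j. c \<bullet> (x (Suc m) - x m))"
    using ij sum_Suc_diff[of i j "\<lambda>m. c \<bullet> x m"] by (simp add: inner_diff_right)
  also have "\<dots> = (\<Sum>m=i..j. l * norm1 (B *v (x (Suc m) - x m)))"
    using level by (intro sum.cong) auto
  also have "\<dots> = l * (\<Sum>s\<in>UNIV. \<Sum>m=i..j. \<bar>D m s\<bar>)"
    by (simp add: sum_distrib_left[symmetric] norm1_def D_def) (rule disjI2, rule sum.swap)
  finally have c_eq: "c \<bullet> (x (Suc j) - x i) = l * (\<Sum>s\<in>UNIV. \<Sum>m=i..j. \<bar>D m s\<bar>)" .
  have "norm1 (B *v (x (Suc j) - x i)) = (\<Sum>s\<in>UNIV. \<bar>\<Sum>m=i..j. D m s\<bar>)"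
    using ij by (simp add: norm1_def sumD matrix_vector_mult_diff_distrib)
  \<comment> \<open>Dividing by the negative \<open>l\<close> reverses the inequality. It is the
    converse of the triangle inequality, which must therefore be an equality in every row.\<close>
  then have "(\<Sum>s\<in>UNIV. \<Sum>m=i..j. \<bar>D m s\<bar>) \<le> (\<Sum>s\<in>UNIV. \<bar>\<Sum>m=i..j. D m s\<bar>)"
    using total neg c_eq by simp
  then have "(\<Sum>s\<in>UNIV. (\<Sum>m=i..j. \<bar>D m s\<bar>) - \<bar>\<Sum>m=i..j. D m s\<bar>) \<le> 0"
    by (simp add: sum_subtractf)
  moreover have nn: "(\<Sum>m=i..j. \<bar>D m s\<bar>) - \<bar>\<Sum>m=i..j. D m s\<bar> \<ge> 0" for s
    by simp
  ultimately have "(\<Sum>s\<in>UNIV. (\<Sum>m=i..j. \<bar>D m s\<bar>) - \<bar>\<Sum>m=i..j. D m s\<bar>) = 0"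
    by (intro antisym sum_nonneg) auto
  then have abs_eq: "(\<Sum>m=i..j. \<bar>D m r\<bar>) = \<bar>\<Sum>m=i..j. D m r\<bar>"
    using sum_nonneg_eq_0_iff[of UNIV "\<lambda>s. (\<Sum>m=i..j. \<bar>D m s\<bar>) - \<bar>\<Sum>m=i..j. D m s\<bar>"] nn by simp
  have split: "(\<Sum>m=i..j. f m) = f i + (\<Sum>m=Suc i..j. f m)" for f :: "nat \<Rightarrow> real"
    using ij by (simp add: sum.atLeast_Suc_atMost)
  have Di: "D i r > 0" using tight by (simp add: D_def)
  \<comment> \<open>Row \<open>r\<close> is tight after step \<open>i\<close> and still satisfied
    after step \<open>j\<close>, so it cannot have increased in between.\<close>
  have le0: "(\<Sum>m=Suc i..j. D m r) \<le> 0"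
    using sumD[of "Suc i" r] ij tight feas by simp
  have tri: "\<bar>\<Sum>m=Suc i..j. D m r\<bar> \<le> (\<Sum>m=Suc i..j. \<bar>D m r\<bar>)" by (rule sum_abs)
  \<comment> \<open>Any decrease after the positive \<open>D i r\<close> would be a cancellation,
    making the triangle inequality strict.\<close>
  have "(\<Sum>m=Suc i..j. \<bar>D m r\<bar>) = 0"
    using abs_eq tri le0 Di unfolding split by linarith
  then have "\<bar>D j r\<bar> = 0"
    using ij by (subst (asm) sum_nonneg_eq_0_iff) auto
  then show ?thesis by (simp add: D_def)
qed

text \<open>The steps are grouped by steepness: each value in \<open>V\<close> occurs at most as
  often as the dimension allows.\<close>

lemma sd_run_length_le:
  fixes A :: "real^'n^'p" and B :: "real^'n^'q"
  assumes pointed: "\<And>y. A *v y = 0 \<Longrightarrow> B *v y = 0 \<Longrightarrow> y = 0"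
    and feas: "\<And>i. i \<le> k \<Longrightarrow> x i \<in> lp_feasible A B b d"
    and step: "\<And>i. i < k \<Longrightarrow> sd_augmentation A B b d c (x i) (x (Suc i))"
  shows "int k \<le> aff_dim (lp_feasible A B b d) *
           int (card (steepness B c ` {g. circuit_direction A B g}))"
proof -
  define P where "P = lp_feasible A B b d"
  define V where "V = steepness B c ` {g. circuit_direction A B g}"
  define D where "D i = x (Suc i) - x i" for i
  define l where "l i = steepness B c (D i)" for i
  have inP: "x i \<in> P" if "i \<le> k" for i using feas that by (simp add: P_def)
  have BD: "B *v D i \<noteq> 0" and neg: "l i < 0" and lV: "l i \<in> V"
    and tight: "\<exists>r. (B *v x (Suc i)) $ r = d $ r \<and> (B *v D i) $ r > 0"
    and lower: "\<And>w. w \<in> P \<Longrightarrow> l i * norm1 (B *v (w - x i)) \<le> c \<bullet> (w - x i)"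
    if "i < k" for i
    using sd_augmentation_displacement[OF pointed feas[of i] step[of i]] that
    unfolding D_def l_def V_def P_def by auto
  have cD: "c \<bullet> D i = l i * norm1 (B *v D i)" if "i < k" for i
    unfolding l_def using steepness_eq_imp[OF BD[OF that]] .
  \<comment> \<open>If step \<open>Suc i\<close> were steeper, the combined displacement of the two
    steps would beat the steepest direction at \<open>x i\<close>.\<close>
  have mono1: "l i \<le> l (Suc i)" if "Suc i < k" for i
  proof -
    have ss: "x (Suc (Suc i)) - x i = D i + D (Suc i)" by (simp add: D_def)
    have "l i * (norm1 (B *v D i) + norm1 (B *v D (Suc i)))
        \<le> l i * norm1 (B *v (D i + D (Suc i)))"
      using neg[of i] that norm1_triangle[of "B *v D i" "B *v D (Suc i)"]
      by (simp add: matrix_vector_right_distrib)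
    also have "\<dots> \<le> c \<bullet> D i + c \<bullet> D (Suc i)"
      using lower[of i "x (Suc (Suc i))"] inP that ss by (simp add: inner_add_right)
    finally have "l i * norm1 (B *v D (Suc i)) \<le> c \<bullet> D (Suc i)"
      using cD[of i] that by (simp add: algebra_simps)
    then show ?thesis using le_steepness_iff[OF BD[OF that]] by (simp add: l_def)
  qed
  have mono: "l i \<le> l j" if "i \<le> j" "j < k" for i j
    using that by (induction j rule: dec_induct) (auto intro: order_trans mono1)
  have "\<exists>r. \<forall>i<k. (B *v x (Suc i)) $ r i = d $ r i \<and> (B *v D i) $ r i > 0"
    using tight by metis
  then obtain r where r: "\<And>i. i < k \<Longrightarrow> (B *v x (Suc i)) $ r i = d $ r i \<and> (B *v D i) $ r i > 0"
    by blast
  \<comment> \<open>Translating \<open>P\<close> to the origin turns its affine dimension into a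
    linear one.\<close>
  define L where "L = (\<lambda>w. - x 0 + w) ` P"
  have x0: "x 0 \<in> P" using inP by simp
  have dimL: "aff_dim P = int (dim L)"
    unfolding L_def by (rule aff_dim_eq_dim) (simp add: x0 hull_inc)
  have DL: "D i \<in> span L" if "i < k" for i
  proof -
    have "D i = (- x 0 + x (Suc i)) - (- x 0 + x i)" by (simp add: D_def)
    moreover have "- x 0 + x (Suc i) \<in> L" "- x 0 + x i \<in> L"
      using inP that by (auto simp: L_def)
    ultimately show ?thesis by (metis span_base span_diff)
  qed
  have level: "card {i. i < k \<and> l i = v} \<le> dim L" for v
  proof -
    define I where "I = {i. i < k \<and> l i = v}"
    have zero: "(B *v D j) $ r i = 0" if "i \<in> I" "j \<in> I" "i < j" for i j
    proof -
      have ik: "i < k" "j < k" "l i = v" "l j = v" using that by (auto simp: I_def)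
      \<comment> \<open>By monotonicity steps of equal steepness are consecutive, so the whole
        stretch has steepness \<open>v\<close>.\<close>
      have lm: "l m = v" if "m \<in> {i..j}" for m
        using mono[of i m] mono[of m j] that ik by auto
      show ?thesis
        unfolding D_def
      proof (rule tight_row_persists[OF \<open>i < j\<close>, where l = v and c = c and d = d])
        show "v < 0" using neg ik by blast
        show "c \<bullet> (x (Suc m) - x m) = v * norm1 (B *v (x (Suc m) - x m))" if "m \<in> {i..j}" for m
          using cD[of m] lm[OF that] that ik by (simp add: D_def)
        show "v * norm1 (B *v (x (Suc j) - x i)) \<le> c \<bullet> (x (Suc j) - x i)"
          using lower[of i "x (Suc j)"] inP ik by simp
        show "(B *v x (Suc i)) $ r i = d $ r i" "(B *v (x (Suc i) - x i)) $ r i > 0"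
          using r[OF ik(1)] by (auto simp: D_def)
        show "(B *v x (Suc j)) $ r i \<le> d $ r i"
          using inP[of "Suc j"] ik by (simp add: P_def lp_feasible_def)
      qed
    qed
    have "inj_on D I \<and> independent (D ` I)"
    \<comment> \<open>The functional for step \<open>i\<close> is the row of \<open>B\<close> that
      blocked it: positive on \<open>D i\<close>, zero on later displacements of the same
      steepness.\<close>
    proof (rule independent_triangular[where w = "\<lambda>i. B $ r i"])
      show "finite I" by (simp add: I_def)
      show "B $ r i \<bullet> D i \<noteq> 0" if "i \<in> I" for i
        using r[of i] that by (auto simp: I_def matrix_vector_mul_component)
      show "B $ r i \<bullet> D j = 0" if "i \<in> I" "j \<in> I" "i < j" for i j
        using zero[OF that] by (simp add: matrix_vector_mul_component)
    qed
    moreover have "D ` I \<subseteq> span L" using DL by (auto simp: I_def)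
    ultimately have "card I \<le> dim (span L)"
      using independent_card_le_dim card_image by metis
    then show ?thesis by (simp add: I_def)
  qed
  have finV: "finite V" unfolding V_def using pointed by (rule finite_circuit_steepness)
  have "{..<k} = (\<Union>v\<in>V. {i. i < k \<and> l i = v})" using lV by auto
  then have "k = card (\<Union>v\<in>V. {i. i < k \<and> l i = v})" by (metis card_lessThan)
  also have "\<dots> \<le> (\<Sum>v\<in>V. card {i. i < k \<and> l i = v})" by (rule card_UN_le[OF finV])
  also have "\<dots> \<le> (\<Sum>v\<in>V. dim L)" by (intro sum_mono level)
  also have "\<dots> = dim L * card V" by simp
  finally have "int k \<le> int (dim L * card V)" by (simp only: of_nat_le_iff)
  then show ?thesis using dimL by (simp add: P_def V_def)
qed

text \<open>Besides the bound, the conclusion states that no run gets stuck: a run that has not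
  reached an optimum has an augmenting direction, and along each such direction there is a maximal
  step or a ray certifying unboundedness.\<close>

theorem theorem1:
  fixes A :: "real^'n^'p" and B :: "real^'n^'q"
    and b :: "real^'p" and d :: "real^'q" and c x0 :: "real^'n"
    and C :: "(real^'n) set"
  assumes pointed: "\<And>y. A *v y = 0 \<Longrightarrow> B *v y = 0 \<Longrightarrow> y = 0"
    and circuits: "circuit_set A B C"
    and feasible: "x0 \<in> lp_feasible A B b d"
  shows "\<forall>k x. sd_run A B b d c x0 k x \<longrightarrow>
     int k \<le> aff_dim (lp_feasible A B b d) * int (card {steepness B c g | g. g \<in> C}) \<and>
     (lp_optimal A B b d c (x k) \<or> (\<exists>y. sd_augmenting A B b d c (x k) y)) \<and>
     (\<forall>y. sd_augmenting A B b d c (x k) y \<longrightarrow>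
        feasible_ray A B b d (x k) y \<or> (\<exists>\<alpha>. maximal_step A B b d (x k) y \<alpha>))"
proof (intro allI impI)
  fix k x assume run: "sd_run A B b d c x0 k x"
  have step: "sd_augmentation A B b d c (x i) (x (Suc i))" if "i < k" for i
    using run that by (simp add: sd_run_def)
  have feas: "x i \<in> lp_feasible A B b d" if "i \<le> k" for i
    using that
  proof (induction i)
    case 0
    then show ?case using run feasible by (simp add: sd_run_def)
  next
    case (Suc i)
    then show ?case
      using step[of i] by (auto simp: sd_augmentation_def maximal_step_def)
  qed
  have "int k \<le> aff_dim (lp_feasible A B b d) * int (card {steepness B c g | g. g \<in> C})"
    unfolding circuit_set_steepness[OF circuits]
    by (rule sd_run_length_le[where x = x]) (use pointed feas step in auto)
  moreover have "lp_optimal A B b d c (x k) \<or> (\<exists>y. sd_augmenting A B b d c (x k) y)"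
    using optimal_or_sd_augmenting[OF pointed feas[OF order_refl]] .
  moreover have "feasible_ray A B b d (x k) y \<or> (\<exists>\<alpha>. maximal_step A B b d (x k) y \<alpha>)"
    if "sd_augmenting A B b d c (x k) y" for y
    using that feasible_ray_or_maximal_step[OF feas[OF order_refl]]
    by (simp add: sd_augmenting_def steepest_descent_direction_def)
  ultimately show "int k \<le> aff_dim (lp_feasible A B b d) * int (card {steepness B c g | g. g \<in> C}) \<and>
     (lp_optimal A B b d c (x k) \<or> (\<exists>y. sd_augmenting A B b d c (x k) y)) \<and>
     (\<forall>y. sd_augmenting A B b d c (x k) y \<longrightarrow>
        feasible_ray A B b d (x k) y \<or> (\<exists>\<alpha>. maximal_step A B b d (x k) y \<alpha>))"
    by blast
qed

end
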